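(* Let $f$ range over a finite nonempty set of flavors, and for $m_f>0$, $\Sigma_{\rm F}>0$, $A_{\rm F}>0$ let $$\chi_{\rm top}^{\rm F}=\left[\frac{1}{A_{\rm F}}+\sum_f\frac{1}{m_f\Sigma_{\rm F}}\right]^{-1}.$$ Then: (i) (heavy-quark limit) for fixed $A_{\rm F},\Sigma_{\rm F}$, $\chi_{\rm top}^{\rm F}\to A_{\rm F}$ as $m_f\to\infty$ for all $f$; (ii) (light-quark regime) $\chi_{\rm top}^{\rm F}$ reduces to $\Sigma_{\rm F}\big/\sum_f\frac{1}{m_f}$, i.e. with $m_*=\big(\sum_f 1/m_f\big)^{-1}$, the ratio $\chi_{\rm top}^{\rm F}/(m_*\Sigma_{\rm F})$ tends to $1$ as $m_*\Sigma_{\rm F}/A_{\rm F}\to0$; (iii) (massless-quark limit) for any one flavor $f_0$, with $A_{\rm F}$, $\Sigma_{\rm F}$ and the other masses fixed, $\chi_{\rm top}^{\rm F}\to0$ as $m_{f_0}\to0^+$.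
   Context: The $m_f$ are quark masses, $\Sigma_{\rm F}$ a chiral condensate and $A_{\rm F}$ a pure Yang--Mills topological stiffness, all treated here as positive real parameters. *)

theory Defs
  imports Complex_Main
begin

definition chi_top :: "'f set \<Rightarrow> real \<Rightarrow> real \<Rightarrow> ('f \<Rightarrow> real) \<Rightarrow> real" where
  "chi_top F A S m = inverse (1 / A + (\<Sum>f\<in>F. 1 / (m f * S)))"

definition m_star :: "'f set \<Rightarrow> ('f \<Rightarrow> real) \<Rightarrow> real" where
  "m_star F m = inverse (\<Sum>f\<in>F. 1 / m f)"

(* All masses tend to infinity jointly, at unrelated rates: for finite F a property holds
   eventually iff there is an M such that it holds for every m with m f > M for all f in F.
   In particular the masses are eventually positive. *)
definition heavy_masses :: "'f set \<Rightarrow> ('f \<Rightarrow> real) filter" where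
  "heavy_masses F = (INF f\<in>F. filtercomap (\<lambda>m. m f) at_top)"

(* A, S and the masses may all vary, as long as they stay positive and m_star F m * S / A
   tends to 0: for finite nonempty F a property holds eventually iff there is a d > 0 such that it holds for all
   positive A, S, m with m_star F m * S / A < d. *)
definition light_regime :: "'f set \<Rightarrow> (real \<times> real \<times> ('f \<Rightarrow> real)) filter" where
  "light_regime F =
     inf (filtercomap (\<lambda>(A, S, m). m_star F m * S / A) (at_right 0))
         (principal {(A, S, m). A > 0 \<and> S > 0 \<and> (\<forall>f\<in>F. m f > 0)})"

end

theory Submission
  imports Defs
begin

text \<open>Everything is read off the reciprocal, 1/\<open>chi_top\<close> = 1/A + \<Sum> 1/(m f *
  S) = 1/A + 1/(\<open>m_star\<close> * S). If all masses grow, the sum vanishes and 1/A survives.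
  If a single mass tends to 0+, its term blows up and the inverse collapses to 0. For light quarks,
  multiplying by \<open>m_star\<close> * S gives an exact formula: the ratio is 1/(1 + r) with r =
  \<open>m_star\<close> * S / A (\<open>chi_top_div_m_star\<close>), so only r \<rightarrow> 0
  matters, however A, S and the masses vary.\<close>

lemma sum_inverse_mult_const:
  fixes m :: "'f \<Rightarrow> real"
  shows "(\<Sum>f\<in>F. 1 / (m f * S)) = (\<Sum>f\<in>F. 1 / m f) / S"
  by (simp add: sum_divide_distrib)

lemma chi_top_heavy_limit:
  assumes "A > 0" "S > 0"
  shows "((\<lambda>m. chi_top F A S m) \<longlongrightarrow> A) (heavy_masses F)"
proof -
  have "((\<lambda>m. 1 / (m f * S)) \<longlongrightarrow> 0) (heavy_masses F)" if "f \<in> F" for f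
  proof -
    have "filterlim (\<lambda>m. m f) at_top (heavy_masses F)"
      \<comment> \<open>The infimum lies below each of its members, so every single mass tends to
        infinity, with no relation between the rates.\<close>
      unfolding heavy_masses_def by (rule filterlim_INF'[OF that filterlim_filtercomap])
    then have "filterlim (\<lambda>m. m f * S) at_top (heavy_masses F)"
      by (rule filterlim_at_top_mult_tendsto_pos[OF tendsto_const \<open>S > 0\<close>])
    then show ?thesis
      by (intro tendsto_divide_0[OF tendsto_const] filterlim_at_top_imp_at_infinity)
  qed
  then have "((\<lambda>m. \<Sum>f\<in>F. 1 / (m f * S)) \<longlongrightarrow> (\<Sum>f\<in>F. 0)) (heavy_masses F)"
    by (rule tendsto_sum)
  then have "((\<lambda>m. inverse (1 / A + (\<Sum>f\<in>F. 1 / (m f * S)))) \<longlongrightarrow> inverse (1 / A + (\<Sum>f\<in>F. 0)))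
      (heavy_masses F)"
    \<comment> \<open>Since A > 0, the limit 1/A of the reciprocal is nonzero, so inversion is
      continuous there.\<close>
    using \<open>A > 0\<close> by (intro tendsto_inverse tendsto_add tendsto_const) auto
  then show ?thesis
    by (simp add: chi_top_def)
qed

lemma chi_top_div_m_star:
  assumes "finite F" "F \<noteq> {}" "A > 0" "S > 0" "\<forall>f\<in>F. m f > 0"
  shows "chi_top F A S m / (m_star F m * S) = inverse (1 + m_star F m * S / A)"
proof -
  define T where "T = (\<Sum>f\<in>F. 1 / m f)"
  have "T > 0"
    unfolding T_def using assms by (intro sum_pos) auto
  \<comment> \<open>The right side is the reciprocal of \<open>chi_top\<close> times
    \<open>m_star\<close> * S; T > 0 and S > 0 make the second product cancel to 1.\<close>
  then have "1 + inverse T * S / A = (1 / A + T / S) * (inverse T * S)"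
    using assms by (simp add: field_simps)
  then show ?thesis
    using \<open>T > 0\<close> \<open>S > 0\<close>
    unfolding chi_top_def m_star_def sum_inverse_mult_const T_def[symmetric]
    by (simp add: divide_inverse mult_ac)
qed

lemma chi_top_light_limit:
  assumes "finite F" "F \<noteq> {}"
  shows "((\<lambda>(A, S, m). chi_top F A S m / (m_star F m * S)) \<longlongrightarrow> 1) (light_regime F)"
proof -
  let ?r = "\<lambda>(A, S, m). m_star F m * S / A"
  have "filterlim ?r (at_right 0) (light_regime F)"
    unfolding light_regime_def
    by (rule filterlim_mono[OF filterlim_filtercomap order_refl inf_le1])
  then have "(?r \<longlongrightarrow> 0) (light_regime F)"
    by (simp add: filterlim_at)
  then have "((\<lambda>x. inverse (1 + ?r x)) \<longlongrightarrow> inverse (1 + 0)) (light_regime F)"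
    by (intro tendsto_intros) auto
  \<comment> \<open>The exact formula needs positive parameters, which the principal part of
    \<open>light_regime\<close> supplies.\<close>
  moreover have "\<forall>\<^sub>F x in light_regime F. inverse (1 + ?r x) =
      (\<lambda>(A, S, m). chi_top F A S m / (m_star F m * S)) x"
    unfolding light_regime_def eventually_inf_principal
    by (rule always_eventually) (auto simp: chi_top_div_m_star[OF assms])
  ultimately show ?thesis
    by (simp add: tendsto_cong)
qed

lemma chi_top_massless_limit:
  assumes "finite F" "f0 \<in> F" "S > 0"
  shows "((\<lambda>x. chi_top F A S (m(f0 := x))) \<longlongrightarrow> 0) (at_right 0)"
proof -
  \<comment> \<open>C collects all terms free of the varying mass; what remains is 1/(x * S), which
    tends to infinity as x \<rightarrow> 0+ and dominates any constant.\<close>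
  define C where "C = 1 / A + (\<Sum>f\<in>F - {f0}. 1 / (m f * S))"
  have chi: "chi_top F A S (m(f0 := x)) = inverse (C + inverse x * (1 / S))" for x
  proof -
    have "(\<Sum>f\<in>F - {f0}. 1 / ((m(f0 := x)) f * S)) = (\<Sum>f\<in>F - {f0}. 1 / (m f * S))"
      by (rule sum.cong) auto
    then show ?thesis
      unfolding chi_top_def C_def sum.remove[OF assms(1,2)]
      by (simp add: divide_inverse add_ac)
  qed
  have "filterlim (\<lambda>x. inverse x * (1 / S)) at_top (at_right 0)"
    using \<open>S > 0\<close>
    by (intro filterlim_at_top_mult_tendsto_pos[OF tendsto_const _ filterlim_inverse_at_top_right]) auto
  then have "filterlim (\<lambda>x. C + inverse x * (1 / S)) at_top (at_right 0)"
    by (rule filterlim_tendsto_add_at_top[OF tendsto_const])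
  then show ?thesis
    unfolding chi
    by (intro tendsto_inverse_0[THEN filterlim_compose] filterlim_at_top_imp_at_infinity)
qed

theorem proposition1:
  fixes F :: "'f set"
  assumes "finite F" and "F \<noteq> {}"
  shows
    "(\<forall>A>0. \<forall>S>0. ((\<lambda>m. chi_top F A S m) \<longlongrightarrow> A) (heavy_masses F))
   \<and> ((\<forall>S>0. \<forall>m. (\<forall>f\<in>F. m f > 0) \<longrightarrow> m_star F m * S = S / (\<Sum>f\<in>F. 1 / m f))
      \<and> ((\<lambda>(A, S, m). chi_top F A S m / (m_star F m * S)) \<longlongrightarrow> 1) (light_regime F))
   \<and> (\<forall>A>0. \<forall>S>0. \<forall>m. \<forall>f0\<in>F. (\<forall>f\<in>F - {f0}. m f > 0) \<longrightarrow>
        ((\<lambda>x. chi_top F A S (m(f0 := x))) \<longlongrightarrow> 0) (at_right 0))"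
proof (intro conjI)
  show "\<forall>S>0. \<forall>m. (\<forall>f\<in>F. m f > 0) \<longrightarrow> m_star F m * S = S / (\<Sum>f\<in>F. 1 / m f)"
    by (simp add: m_star_def divide_inverse mult.commute)
qed (simp_all add: assms chi_top_heavy_limit chi_top_light_limit chi_top_massless_limit)

end
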